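(* For every $d>0$ there exists a constant $K(d)>1$ such that the following holds. Let $z_0,z_1,\dots,z_n=z_0$ be a finite cyclic sequence of nonzero points of $\mathbb{D}$ such that, for each $i\in\{0,\dots,n-1\}$, $z_i$ and $z_{i+1}$ are joined by a path $\gamma_i$ in $\mathbb{D}$ that avoids $0$ and has hyperbolic length at most $d$ in $\mathbb{D}$, and such that the closed path obtained by concatenating the $\gamma_i$ winds at least once around $0$ (its winding number about $0$ is nonzero). Put $\mathcal{Z}=\{z_1,\dots,z_n\}$ and let $r'$ be the conformal radius of $\mathbb{D}\setminus\mathcal{Z}$ at $0$. Then $$\ln r'\ \le\ \frac{\ln\left(\max_i|z_i|\right)}{K(d)}\ (<0).$$
   Context: $\mathbb{D}$ is the open unit disc of $\mathbb{C}$. The conformal radius at $0$ of a domain $V\subset\mathbb{D}$ containing $0$ is $|\phi'(0)|$, where $\phi:(\mathbb{D},0)\to(V,0)$ is a holomorphic universal covering with $\phi(0)=0$. Hyperbolic lengths in $\mathbb{D}$ are taken for the metric $|dz|/(1-|z|^2)$, so that the distance from $0$ to $x\in[0,1)$ is $\tanh^{-1}(x)$. *)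

theory Defs
  imports "HOL-Complex_Analysis.Complex_Analysis"
begin

text \<open>
  The conformal radius at 0 of a domain V in the unit disc, as a relation. As the unit disc is
  simply connected, a covering of V by it is a universal covering.
\<close>

definition is_conformal_radius :: "complex set \<Rightarrow> real \<Rightarrow> bool" where
  "is_conformal_radius V r \<longleftrightarrow>
     (\<exists>\<phi>. \<phi> holomorphic_on ball 0 1 \<and> covering_space (ball 0 1) \<phi> V \<and>
          \<phi> 0 = 0 \<and> r = norm (deriv \<phi> 0))"

text \<open>
  Length for the metric |dz| / (1 - |z|^2) of an absolutely continuous path in the unit disc:
  the function g is the derivative of the path almost everywhere. Every rectifiable path can be
  parametrised in this way. Using has_integral rather than the total function integral
  ensures that a path of infinite length has no length, rather than length 0.
\<close>

definition has_hyperbolic_length :: "(real \<Rightarrow> complex) \<Rightarrow> real \<Rightarrow> bool" where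
  "has_hyperbolic_length \<gamma> L \<longleftrightarrow>
     (\<exists>g. g absolutely_integrable_on {0..1} \<and>
          (\<forall>t\<in>{0..1}. (g has_integral (\<gamma> t - \<gamma> 0)) {0..t}) \<and>
          ((\<lambda>t. norm (g t) / (1 - (norm (\<gamma> t))\<^sup>2)) has_integral L) {0..1})"

text \<open>For piecewise continuously differentiable paths this is the usual integral.\<close>

lemma has_hyperbolic_length_valid_path:
  assumes "valid_path \<gamma>" "path_image \<gamma> \<subseteq> ball 0 1"
    and L: "((\<lambda>t. norm (vector_derivative \<gamma> (at t)) / (1 - (norm (\<gamma> t))\<^sup>2)) has_integral L) {0..1}"
  shows "has_hyperbolic_length \<gamma> L"
proof -
  obtain S where S: "finite S" "continuous_on {0..1} \<gamma>" "\<gamma> C1_differentiable_on ({0..1} - S)"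
    using assms(1) by (auto simp: valid_path_def piecewise_C1_differentiable_on_def)
  have D: "(\<gamma> has_vector_derivative vector_derivative \<gamma> (at t)) (at t)" if "t \<in> {0..1} - S" for t
    using S(3) that by (auto simp: C1_differentiable_on_eq vector_derivative_works)
  have ftc: "((\<lambda>t. vector_derivative \<gamma> (at t)) has_integral (\<gamma> t - \<gamma> 0)) {0..t}"
    if "t \<in> {0..1}" for t
  proof (rule fundamental_theorem_of_calculus_interior_strong[OF S(1)])
    show "continuous_on {0..t} \<gamma>"
      using S(2) that by (auto intro: continuous_on_subset)
  qed (use that D in auto)
  have "(\<lambda>t. vector_derivative \<gamma> (at t)) absolutely_integrable_on {0..1}"
  proof (rule measurable_bounded_by_integrable_imp_absolutely_integrable)
    show "(\<lambda>t. vector_derivative \<gamma> (at t)) \<in> borel_measurable (lebesgue_on {0..1})"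
      using ftc[of 1] by (intro integrable_imp_measurable) auto
    show "(\<lambda>t. norm (vector_derivative \<gamma> (at t)) / (1 - (norm (\<gamma> t))\<^sup>2)) integrable_on {0..1}"
      using L by blast
    show "norm (vector_derivative \<gamma> (at t)) \<le> norm (vector_derivative \<gamma> (at t)) / (1 - (norm (\<gamma> t))\<^sup>2)"
      if "t \<in> {0..1}" for t
    proof -
      have "\<gamma> t \<in> ball 0 1"
        using assms(2) that unfolding path_image_def by blast
      then have "(norm (\<gamma> t))\<^sup>2 < 1"
        by (simp add: power_less_one_iff abs_square_less_1)
      then show ?thesis
        by (simp add: field_simps mult_left_le)
    qed
  qed auto
  then show ?thesis
    unfolding has_hyperbolic_length_def using ftc L by blast
qed

text \<open>The concatenation of the first n of a sequence of paths, for n at least 1.\<close>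

definition concat_paths :: "(nat \<Rightarrow> real \<Rightarrow> complex) \<Rightarrow> nat \<Rightarrow> real \<Rightarrow> complex" where
  "concat_paths \<gamma> n = foldl (+++) (\<gamma> 0) (map \<gamma> [1..<n])"

end

theory Submission
  imports Defs
begin

text \<open>
  The hyperbolic derivative of a holomorphic map of the disc cannot have a local maximum with value
  greater than 1 (Ahlfors). The covering \<open>\<phi>\<close> omits the \<open>z i\<close>, so at points where \<open>\<phi>\<close> takes
  values on the closed curve, hence within distance d of some \<open>z i\<close>, its hyperbolic derivative is at
  most some \<open>\<kappa> < 1\<close> depending only on d. This leaves room to shrink the target disc slightly: with R
  close to 1, \<open>\<phi> / R\<close> still has hyperbolic derivative at most 1 over the curve, and the
  region around which the curve winds lies in the disc of radius R. The maximum principle on the preimage of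
  that region gives \<open>\<bar>\<phi>'(0)\<bar> \<le> R\<close>, with \<open>1 - R\<close> comparable to \<open>1 - max \<bar>z i\<bar>\<close>. When \<open>max \<bar>z i\<bar>\<close> is
  small, a single omitted point already suffices.
\<close>

section \<open>The maximum principle for hyperbolic derivatives\<close>

text \<open>Divided by the first square on the right, this is the formula for one minus the squared
  pseudo-hyperbolic distance of \<open>a\<close> and \<open>w\<close> in the disc of radius
  \<open>t\<close>.\<close>

lemma cmod_one_minus_cnj_mult_identity:
  "(t\<^sup>2 - (cmod a)\<^sup>2) * (t\<^sup>2 - (cmod w)\<^sup>2) = (cmod (of_real (t\<^sup>2) - cnj a * w))\<^sup>2 - t\<^sup>2 * (cmod (w - a))\<^sup>2"
  unfolding cmod_power2 by (simp add: algebra_simps power2_eq_square)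

lemma cmod_one_minus_cnj_mult_identity_1:
  "(1 - (cmod a)\<^sup>2) * (1 - (cmod w)\<^sup>2) = (cmod (1 - cnj a * w))\<^sup>2 - (cmod (w - a))\<^sup>2"
  using cmod_one_minus_cnj_mult_identity[of 1 a w] by simp

lemma one_minus_cnj_mult_nonzero:
  assumes "cmod a < 1" "cmod w < 1"
  shows "1 - cnj a * w \<noteq> 0"
proof -
  have "cmod (cnj a * w) < 1 * 1"
    unfolding norm_mult using assms by (intro mult_strict_mono') auto
  then show ?thesis by auto
qed

text \<open>The quotient compared here is \<open>t\<close> times the hyperbolic derivative of
  \<open>f\<close> from the disc of radius \<open>t\<close> to the unit disc, and \<open>big\<close>
  says that this derivative exceeds 1 at \<open>a\<close>. Then \<open>f\<close> expands
  pseudo-hyperbolic distances from \<open>a\<close> to nearby points, which turns a weak maximum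
  modulus inequality into a strict increase of the quotient.\<close>

lemma hyperbolic_derivative_no_local_max:
  fixes f :: "complex \<Rightarrow> complex"
  assumes holf: "f holomorphic_on ball 0 1" and t: "0 < t" "t \<le> 1" and a: "cmod a < t"
    and V: "open V" "a \<in> V" and fa: "cmod (f a) < 1"
    and big: "t * (1 - (cmod (f a))\<^sup>2) < cmod (deriv f a) * (t\<^sup>2 - (cmod a)\<^sup>2)"
  obtains w where "w \<in> V" "cmod w < t" "cmod (f w) < 1"
    "cmod (deriv f a) * (t\<^sup>2 - (cmod a)\<^sup>2) / (1 - (cmod (f a))\<^sup>2)
      < cmod (deriv f w) * (t\<^sup>2 - (cmod w)\<^sup>2) / (1 - (cmod (f w))\<^sup>2)"
proof -
  define b where "b = f a"
  have b1: "(cmod b)\<^sup>2 < 1"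
    using fa by (simp add: b_def abs_square_less_1)
  have at2: "(cmod a)\<^sup>2 < t\<^sup>2"
    using a by (intro power_strict_mono) auto
  have contf: "isCont f a"
    using holf a t holomorphic_on_imp_continuous_on continuous_on_eq_continuous_at[of "ball 0 1" f]
    by force
  \<comment> \<open>For \<open>w\<close> different from \<open>a\<close>, \<open>r w > 0\<close>
    says that \<open>f w\<close> and \<open>f a\<close> are farther apart in the unit disc than
    \<open>w\<close> and \<open>a\<close> in the disc of radius \<open>t\<close>. Its limit at
    \<open>a\<close> is positive by \<open>big\<close>.\<close>
  define r where "r w = cmod ((f w - f a) / (w - a)) * cmod (of_real (t\<^sup>2) - cnj a * w)
      - t * cmod (1 - cnj b * f w)" for w
  have da: "(f has_field_derivative deriv f a) (at a)"
    using holf a t by (intro holomorphic_derivI[of f "ball 0 1"]) auto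
  have "(r \<longlongrightarrow> cmod (deriv f a) * cmod (of_real (t\<^sup>2) - cnj a * a) - t * cmod (1 - cnj b * f a)) (at a)"
    unfolding r_def using da contf
    by (intro tendsto_intros) (auto simp: has_field_derivative_iff isCont_def)
  moreover have "cmod (of_real (t\<^sup>2) - cnj a * a) = t\<^sup>2 - (cmod a)\<^sup>2"
  proof -
    have "of_real (t\<^sup>2) - cnj a * a = complex_of_real (t\<^sup>2 - (cmod a)\<^sup>2)"
      using complex_norm_square[of a] by (simp add: mult.commute)
    then show ?thesis using at2 by (metis abs_of_pos diff_gt_0_iff_gt norm_of_real)
  qed
  moreover have "cmod (1 - cnj b * f a) = 1 - (cmod b)\<^sup>2"
  proof -
    have "1 - cnj b * f a = complex_of_real (1 - (cmod b)\<^sup>2)"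
      using complex_norm_square[of b] by (simp add: b_def mult.commute)
    then show ?thesis using b1 by (metis abs_of_pos diff_gt_0_iff_gt norm_of_real)
  qed
  ultimately have "\<forall>\<^sub>F w in at a. r w > 0"
    using big by (intro order_tendstoD(1)) (auto simp: b_def)
  moreover have "\<forall>\<^sub>F w in at a. cmod (f w) < 1"
    using contf fa by (intro order_tendstoD(2)[of "\<lambda>w. cmod (f w)"]) (auto intro!: tendsto_intros simp: isCont_def)
  moreover have "\<forall>\<^sub>F w in at a. w \<in> V \<inter> ball 0 t"
    using V a by (intro eventually_at_in_open') auto
  ultimately have "\<forall>\<^sub>F w in at a. r w > 0 \<and> cmod (f w) < 1 \<and> w \<in> V \<inter> ball 0 t"
    by eventually_elim auto
  then obtain e where "e > 0"
    and e: "\<And>w. w \<noteq> a \<Longrightarrow> dist w a < e \<Longrightarrow> r w > 0 \<and> cmod (f w) < 1 \<and> w \<in> V \<inter> ball 0 t"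
    unfolding eventually_at by auto
  have eB: "w \<in> V \<inter> ball 0 t \<and> cmod (f w) < 1" if "w \<in> ball a e" for w
    using e[of w] that V a fa by (cases "w = a") (auto simp: dist_commute)
  have sub: "ball a e \<subseteq> ball 0 1"
    using eB t by force
  \<comment> \<open>By the Moebius identities for a and b, the hyperbolic derivative at w is \<open>\<bar>H w\<bar>\<close> times a factor that is
    smallest at a, as f expands near a; the maximum modulus principle applies to H.\<close>
  define H where "H w = deriv f w * (of_real (t\<^sup>2) - cnj a * w)\<^sup>2 / (1 - cnj b * f w)\<^sup>2" for w
  have holH: "H holomorphic_on ball a e"
    unfolding H_def
    using holomorphic_on_subset[OF holf sub] eB one_minus_cnj_mult_nonzero[of b] fa
    by (intro holomorphic_intros) (auto simp: b_def)
  \<comment> \<open>If no value of \<open>H\<close> is larger in modulus than \<open>H a\<close>,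
    then \<open>H\<close> is constant and any other point serves. Only \<open>w \<noteq> a\<close>
    matters then: the strictness comes from \<open>r w > 0\<close>.\<close>
  obtain w where w: "w \<in> ball a e" "w \<noteq> a" "cmod (H a) \<le> cmod (H w)"
  proof (cases "\<exists>w\<in>ball a e. cmod (H a) < cmod (H w)")
    case True
    then show ?thesis using that by fastforce
  next
    case False
    then have "H constant_on ball a e"
      using maximum_modulus_principle[OF holH open_ball connected_ball open_ball order_refl, of a] \<open>e > 0\<close>
      by force
    then have "H (a + of_real (e/2)) = H a"
      using \<open>e > 0\<close> unfolding constant_on_def by (auto simp: dist_norm)
    then show ?thesis
      using that[of "a + of_real (e/2)"] \<open>e > 0\<close> by (auto simp: dist_norm)
  qed
  have rw: "r w > 0" and fw: "cmod (f w) < 1" and wt: "cmod w < t" and wV: "w \<in> V"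
    using e[of w] w by (auto simp: dist_commute)
  define A where "A = (cmod (of_real (t\<^sup>2) - cnj a * w))\<^sup>2"
  define B where "B = (cmod (1 - cnj b * f w))\<^sup>2"
  have fw1: "(cmod (f w))\<^sup>2 < 1"
    using fw by (simp add: abs_square_less_1)
  have wt2: "(cmod w)\<^sup>2 < t\<^sup>2"
    using wt by (intro power_strict_mono) auto
  have Aid: "(t\<^sup>2 - (cmod a)\<^sup>2) * (t\<^sup>2 - (cmod w)\<^sup>2) = A - t\<^sup>2 * (cmod (w - a))\<^sup>2"
    unfolding A_def by (rule cmod_one_minus_cnj_mult_identity)
  have Bid: "(1 - (cmod b)\<^sup>2) * (1 - (cmod (f w))\<^sup>2) = B - (cmod (f w - f a))\<^sup>2"
    unfolding B_def by (subst cmod_one_minus_cnj_mult_identity_1) (simp add: b_def)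
  have A0: "A > 0"
  proof -
    have "0 < (t\<^sup>2 - (cmod a)\<^sup>2) * (t\<^sup>2 - (cmod w)\<^sup>2)" using at2 wt2 by simp
    also have "\<dots> \<le> A" using Aid by simp
    finally show ?thesis .
  qed
  have B0: "B > 0"
    unfolding B_def using one_minus_cnj_mult_nonzero[of b "f w"] fa fw by (simp add: b_def)
  have "t * cmod (1 - cnj b * f w) * cmod (w - a) < cmod (f w - f a) * cmod (of_real (t\<^sup>2) - cnj a * w)"
    using rw \<open>w \<noteq> a\<close> by (simp add: r_def norm_divide field_simps)
  then have "(t * cmod (1 - cnj b * f w) * cmod (w - a))\<^sup>2 < (cmod (f w - f a) * cmod (of_real (t\<^sup>2) - cnj a * w))\<^sup>2"
    using t by (intro power_strict_mono) auto
  then have key: "t\<^sup>2 * B * (cmod (w - a))\<^sup>2 < (cmod (f w - f a))\<^sup>2 * A"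
    by (simp add: A_def B_def power_mult_distrib)
  have key': "(1 - (cmod b)\<^sup>2) * (1 - (cmod (f w))\<^sup>2) * A < (t\<^sup>2 - (cmod a)\<^sup>2) * (t\<^sup>2 - (cmod w)\<^sup>2) * B"
    unfolding Aid Bid using key by (simp add: algebra_simps)
  have Ha: "cmod (H a) = cmod (deriv f a) * (t\<^sup>2 - (cmod a)\<^sup>2)\<^sup>2 / (1 - (cmod b)\<^sup>2)\<^sup>2"
    unfolding H_def norm_divide norm_mult norm_power
    using \<open>cmod (of_real (t\<^sup>2) - cnj a * a) = _\<close> \<open>cmod (1 - cnj b * f a) = _\<close> by simp
  have Hw: "cmod (H w) = cmod (deriv f w) * A / B"
    by (simp add: H_def A_def B_def norm_divide norm_mult norm_power)
  have Dw: "cmod (deriv f w) = cmod (H w) * B / A"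
    using A0 B0 by (simp add: Hw)
  have fpos: "1 - (cmod b)\<^sup>2 > 0" "1 - (cmod (f w))\<^sup>2 > 0" "t\<^sup>2 - (cmod a)\<^sup>2 > 0" "t\<^sup>2 - (cmod w)\<^sup>2 > 0"
    using b1 fw1 at2 wt2 by auto
  have Da: "0 < cmod (deriv f a)"
  proof -
    have "0 < t * (1 - (cmod (f a))\<^sup>2)" using t fpos(1) by (simp add: b_def)
    then have "deriv f a \<noteq> 0" using big by auto
    then show ?thesis by simp
  qed
  then have Ha0: "0 < cmod (H a)" unfolding Ha using fpos by simp
  have "cmod (deriv f a) * (t\<^sup>2 - (cmod a)\<^sup>2) / (1 - (cmod b)\<^sup>2)
      = cmod (H a) * ((1 - (cmod b)\<^sup>2) / (t\<^sup>2 - (cmod a)\<^sup>2))"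
    unfolding Ha using fpos by (simp add: power2_eq_square)
  also have "\<dots> < cmod (H a) * (B * (t\<^sup>2 - (cmod w)\<^sup>2) / (A * (1 - (cmod (f w))\<^sup>2)))"
    using key' Ha0 fpos A0 B0 by (intro mult_strict_left_mono) (simp_all add: field_simps)
  also have "\<dots> \<le> cmod (H w) * (B * (t\<^sup>2 - (cmod w)\<^sup>2) / (A * (1 - (cmod (f w))\<^sup>2)))"
    using w(3) fpos A0 B0 by (intro mult_right_mono) simp_all
  also have "\<dots> = cmod (deriv f w) * (t\<^sup>2 - (cmod w)\<^sup>2) / (1 - (cmod (f w))\<^sup>2)"
    unfolding Dw by simp
  finally show ?thesis
    using that[of w] wV wt fw by (simp add: b_def)
qed

text \<open>On each smaller disc the hyperbolic derivative attains its maximum over the compact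
  preimage of \<open>C\<close>. A maximum above 1 cannot lie on the rim, where the quotient
  vanishes, nor over \<open>C - U\<close> by \<open>bdry\<close>, nor over \<open>U\<close> by the
  previous lemma. Then let the radius tend to 1.\<close>

lemma hyperbolic_derivative_le_1:
  fixes f :: "complex \<Rightarrow> complex"
  assumes holf: "f holomorphic_on ball 0 1" and "open U" "closed C" "U \<subseteq> C"
    and fC: "\<And>w. cmod w < 1 \<Longrightarrow> f w \<in> C \<Longrightarrow> cmod (f w) < 1"
    and bdry: "\<And>w. cmod w < 1 \<Longrightarrow> f w \<in> C - U \<Longrightarrow> cmod (deriv f w) * (1 - (cmod w)\<^sup>2) \<le> 1 - (cmod (f w))\<^sup>2"
    and w: "cmod w < 1" "f w \<in> C"
  shows "cmod (deriv f w) * (1 - (cmod w)\<^sup>2) \<le> 1 - (cmod (f w))\<^sup>2"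
proof -
  have contf: "continuous_on (ball 0 1) f"
    using holf by (rule holomorphic_on_imp_continuous_on)
  have contd: "continuous_on (ball 0 1) (deriv f)"
    using holf by (intro holomorphic_on_imp_continuous_on holomorphic_deriv) auto
  have main: "cmod (deriv f w) * (t\<^sup>2 - (cmod w)\<^sup>2) \<le> t * (1 - (cmod (f w))\<^sup>2)"
    if t: "cmod w < t" "t < 1" for t
  proof (rule ccontr)
    assume contra: "\<not> ?thesis"
    have t0: "0 < t" using t(1) norm_ge_zero[of w] by linarith
    define S where "S = {u \<in> cball 0 t. f u \<in> C}"
    define q where "q u = cmod (deriv f u) * (t\<^sup>2 - (cmod u)\<^sup>2) / (1 - (cmod (f u))\<^sup>2)" for u
    have sub: "cball 0 t \<subseteq> ball 0 (1::real)" "S \<subseteq> ball 0 1" using t by (auto simp: S_def)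
    have pos: "1 - (cmod (f u))\<^sup>2 > 0" if "u \<in> S" for u
      using fC[of u] that t by (simp add: S_def abs_square_less_1)
    have "closed S"
      unfolding S_def
      using continuous_closed_preimage[OF continuous_on_subset[OF contf sub(1)] closed_cball \<open>closed C\<close>]
      by (auto simp: vimage_def Int_def)
    moreover have "bounded S"
      using bounded_cball[of 0 t] by (rule bounded_subset) (auto simp: S_def)
    ultimately have "compact S" by (simp add: compact_eq_bounded_closed)
    moreover have wS: "w \<in> S" using w t by (auto simp: S_def)
    moreover have "continuous_on S q"
      unfolding q_def
      using continuous_on_subset[OF contf sub(2)] continuous_on_subset[OF contd sub(2)] pos
      by (intro continuous_intros) (auto simp: less_imp_neq[symmetric] dest!: pos)
    ultimately obtain a where a: "a \<in> S" "\<And>u. u \<in> S \<Longrightarrow> q u \<le> q a"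
      using continuous_attains_sup[of S q] by blast
    have "t < q w"
      using contra pos[OF wS] by (simp add: q_def pos_less_divide_eq)
    then have qa: "t < q a" using a(2)[OF wS] by simp
    then have big: "t * (1 - (cmod (f a))\<^sup>2) < cmod (deriv f a) * (t\<^sup>2 - (cmod a)\<^sup>2)"
      using pos[OF a(1)] by (simp add: q_def pos_less_divide_eq)
    have at: "cmod a < t"
    proof (rule ccontr)
      assume "\<not> cmod a < t"
      then have "cmod a = t" using a(1) by (auto simp: S_def)
      then show False using qa t0 by (simp add: q_def)
    qed
    have "f a \<in> U"
    proof (rule ccontr)
      assume "f a \<notin> U"
      then have "cmod (deriv f a) * (1 - (cmod a)\<^sup>2) \<le> 1 - (cmod (f a))\<^sup>2"
        using a(1) bdry[of a] at t by (auto simp: S_def)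
      \<comment> \<open>The hyperbolic density of the smaller disc is the larger one, so the bound
        \<open>bdry\<close> for the unit disc carries over to radius \<open>t\<close>.\<close>
      moreover have "t\<^sup>2 - (cmod a)\<^sup>2 \<le> t * (1 - (cmod a)\<^sup>2)"
      proof -
        have "0 \<le> (1 - t) * (t + (cmod a)\<^sup>2)" using t t0 by simp
        then show ?thesis by (simp add: algebra_simps power2_eq_square)
      qed
      then have "cmod (deriv f a) * (t\<^sup>2 - (cmod a)\<^sup>2) \<le> cmod (deriv f a) * (t * (1 - (cmod a)\<^sup>2))"
        by (intro mult_left_mono) auto
      ultimately have "cmod (deriv f a) * (t\<^sup>2 - (cmod a)\<^sup>2) \<le> t * (1 - (cmod (f a))\<^sup>2)"
        using t0 by (smt (verit) mult.assoc mult.commute mult_left_mono)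
      then show False using big by simp
    qed
    have V: "open (ball 0 1 \<inter> f -` U)"
      using contf \<open>open U\<close> by (intro continuous_open_preimage) auto
    obtain u where u: "u \<in> ball 0 1 \<inter> f -` U" "cmod u < t" "q a < q u"
      unfolding q_def
    proof (rule hyperbolic_derivative_no_local_max[OF holf t0 _ at V _ _ big])
      show "cmod (f a) < 1" using pos[OF a(1)] by (simp add: abs_square_less_1)
    qed (use t at \<open>f a \<in> U\<close> in auto)
    then have "u \<in> S" using \<open>U \<subseteq> C\<close> by (auto simp: S_def)
    then show False using a(2)[of u] u(3) by simp
  qed
  have ev: "\<forall>\<^sub>F t in at_left 1. cmod (deriv f w) * (t\<^sup>2 - (cmod w)\<^sup>2) \<le> t * (1 - (cmod (f w))\<^sup>2)"
    using eventually_at_left[OF w(1)] main w(1) by blast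
  have "((\<lambda>t. cmod (deriv f w) * (t\<^sup>2 - (cmod w)\<^sup>2)) \<longlongrightarrow> cmod (deriv f w) * (1\<^sup>2 - (cmod w)\<^sup>2)) (at_left 1)"
    by (intro tendsto_intros)
  moreover have "((\<lambda>t. t * (1 - (cmod (f w))\<^sup>2)) \<longlongrightarrow> 1 * (1 - (cmod (f w))\<^sup>2)) (at_left 1)"
    by (intro tendsto_intros)
  ultimately show ?thesis
    using tendsto_le[OF trivial_limit_at_left_real _ _ ev] by simp
qed

text \<open>With the whole plane as both sets, there is no boundary condition to check.\<close>

lemma Schwarz_Pick:
  assumes "f holomorphic_on ball 0 1" "\<And>u. cmod u < 1 \<Longrightarrow> cmod (f u) < 1" "cmod w < 1"
  shows "cmod (deriv f w) * (1 - (cmod w)\<^sup>2) \<le> 1 - (cmod (f w))\<^sup>2"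
  by (rule hyperbolic_derivative_le_1[where U=UNIV and C=UNIV]) (use assms in auto)

section \<open>Contraction near an omitted value\<close>

text \<open>After an automorphism moving \<open>p\<close> to 0, the map is the square of a self-map
  \<open>g\<close> of the disc. Squaring has hyperbolic derivative \<open>2 * s / (1 + s^2)\<close>
  at points of modulus \<open>s\<close>, and here \<open>s = sqrt x\<close>. For
  \<open>x < 1\<close> this factor is below 1, which sharpens the Schwarz-Pick inequality.\<close>

lemma hyperbolic_derivative_omitted_value:
  assumes holf: "f holomorphic_on ball 0 1" and im: "\<And>u. cmod u < 1 \<Longrightarrow> cmod (f u) < 1"
    and p: "cmod p < 1" "p \<notin> f ` ball 0 1" and w: "cmod w < 1"
  defines "x \<equiv> cmod ((f w - p) / (1 - cnj p * f w))"
  shows "cmod (deriv f w) * (1 - (cmod w)\<^sup>2) * (1 + x) \<le> 2 * sqrt x * (1 - (cmod (f w))\<^sup>2)"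
proof -
  define F where "F u = (f u - p) / (1 - cnj p * f u)" for u
  have nz: "1 - cnj p * f u \<noteq> 0" if "cmod u < 1" for u
    using im that p by (intro one_minus_cnj_mult_nonzero) auto
  have holF: "F holomorphic_on ball 0 1"
    unfolding F_def using holf nz by (intro holomorphic_intros) auto
  have F0: "F u \<noteq> 0" if "u \<in> ball 0 1" for u
    using p that nz[of u] by (auto simp: F_def)
  have id: "(1 - (cmod (F u))\<^sup>2) * (cmod (1 - cnj p * f u))\<^sup>2 = (1 - (cmod p)\<^sup>2) * (1 - (cmod (f u))\<^sup>2)"
    if "cmod u < 1" for u
    using nz[OF that] by (simp add: cmod_one_minus_cnj_mult_identity_1 F_def norm_divide field_simps)
  have F1: "cmod (F u) < 1" if "cmod u < 1" for u
  proof -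
    have "cmod (f u) < 1" using im that by auto
    then have "0 < (1 - (cmod p)\<^sup>2) * (1 - (cmod (f u))\<^sup>2)"
      using p by (simp add: abs_square_less_1)
    then have "0 < (1 - (cmod (F u))\<^sup>2)"
      using id[OF that] nz[OF that] by (metis zero_less_mult_pos2 zero_less_norm_iff zero_less_power)
    then show ?thesis by (simp add: abs_square_less_1)
  qed
  \<comment> \<open>A square root of F is still a self-map of the disc; apply the Schwarz--Pick inequality to it.\<close>
  obtain g where holg: "g holomorphic_on ball 0 1" and g: "\<And>u. u \<in> ball 0 1 \<Longrightarrow> F u = g u ^ 2"
    using contractible_imp_holomorphic_sqrt[OF holF convex_imp_contractible[OF convex_ball] F0] by blast
  have g1: "cmod (g u) < 1" if "cmod u < 1" for u
    using F1[OF that] g[of u] that by (simp add: norm_power abs_square_less_1)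
  have SP: "cmod (deriv g w) * (1 - (cmod w)\<^sup>2) \<le> 1 - (cmod (g w))\<^sup>2"
    using holg g1 w by (intro Schwarz_Pick) auto
  have x: "x = cmod (F w)" by (simp add: x_def F_def)
  have gx: "(cmod (g w))\<^sup>2 = x"
    using g[of w] w by (simp add: x norm_power)
  then have gs: "cmod (g w) = sqrt x" by (metis norm_ge_zero real_sqrt_unique)
  have dg: "(g has_field_derivative deriv g w) (at w)"
    using holg w by (intro holomorphic_derivI[of g "ball 0 1"]) auto
  have df: "(f has_field_derivative deriv f w) (at w)"
    using holf w by (intro holomorphic_derivI[of f "ball 0 1"]) auto
  have "((\<lambda>u. g u ^ 2) has_field_derivative 2 * g w * deriv g w) (at w)"
    by (rule derivative_eq_intros dg refl | simp)+
  then have "(F has_field_derivative 2 * g w * deriv g w) (at w)"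
    by (rule has_field_derivative_transform_within_open[of _ _ _ "ball 0 1"]) (use g w in auto)
  moreover have "(F has_field_derivative deriv f w * (1 - cnj p * p) / (1 - cnj p * f w)\<^sup>2) (at w)"
    unfolding F_def
    by (rule derivative_eq_intros df refl nz w | simp)+ (simp add: algebra_simps power2_eq_square)
  \<comment> \<open>Both sides are the derivative of \<open>F\<close>, once as a square and once as
    a Moebius image of \<open>f\<close>.\<close>
  ultimately have "2 * g w * deriv g w = deriv f w * (1 - cnj p * p) / (1 - cnj p * f w)\<^sup>2"
    by (rule DERIV_unique)
  then have "cmod (2 * g w * deriv g w) = cmod (deriv f w) * (1 - (cmod p)\<^sup>2) / (cmod (1 - cnj p * f w))\<^sup>2"
  proof -
    have "1 - cnj p * p = complex_of_real (1 - (cmod p)\<^sup>2)"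
      using complex_norm_square[of p] by (simp add: mult.commute)
    moreover have "0 < 1 - (cmod p)\<^sup>2" using p by (simp add: abs_square_less_1)
    ultimately have "cmod (1 - cnj p * p) = 1 - (cmod p)\<^sup>2"
      by (metis abs_of_pos norm_of_real)
    then show ?thesis
      using \<open>2 * g w * deriv g w = _\<close> by (simp add: norm_mult norm_divide norm_power)
  qed
  then have eq: "2 * sqrt x * cmod (deriv g w) * (cmod (1 - cnj p * f w))\<^sup>2 = cmod (deriv f w) * (1 - (cmod p)\<^sup>2)"
    using nz[OF w] gs by (simp add: norm_mult field_simps)
  have p1: "0 < 1 - (cmod p)\<^sup>2" using p by (simp add: abs_square_less_1)
  have x1: "x < 1" "0 \<le> x" using F1[OF w] x by auto
  define N where "N = (cmod (1 - cnj p * f w))\<^sup>2"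
  have N0: "N > 0" using nz[OF w] by (simp add: N_def)
  \<comment> \<open>The extra factor \<open>(1 - x) * (1 - (cmod p)\<^sup>2)\<close> is positive and
    is cancelled at the end. It makes room for \<open>SP\<close>, whose right side is
    \<open>1 - x\<close>, and for \<open>id\<close>.\<close>
  have "cmod (deriv f w) * (1 - (cmod w)\<^sup>2) * (1 + x) * ((1 - x) * (1 - (cmod p)\<^sup>2))
      = (cmod (deriv f w) * (1 - (cmod p)\<^sup>2)) * ((1 - (cmod w)\<^sup>2) * (1 - x\<^sup>2))"
    by (simp add: algebra_simps power2_eq_square)
  also have "\<dots> = 2 * sqrt x * (cmod (deriv g w) * (1 - (cmod w)\<^sup>2)) * ((1 - x\<^sup>2) * N)"
    unfolding eq[symmetric] N_def by (simp add: mult_ac)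
  also have "\<dots> \<le> 2 * sqrt x * (1 - x) * ((1 - x\<^sup>2) * N)"
    using SP gx x1 N0 by (intro mult_right_mono mult_left_mono) (auto simp: power_le_one_iff abs_square_le_1)
  also have "(1 - x\<^sup>2) * N = (1 - (cmod p)\<^sup>2) * (1 - (cmod (f w))\<^sup>2)"
    using id[OF w] by (simp add: x N_def)
  finally have "cmod (deriv f w) * (1 - (cmod w)\<^sup>2) * (1 + x) * ((1 - x) * (1 - (cmod p)\<^sup>2))
     \<le> 2 * sqrt x * (1 - (cmod (f w))\<^sup>2) * ((1 - x) * (1 - (cmod p)\<^sup>2))"
    by (simp only: mult_ac)
  then show ?thesis
    using p1 x1 by (auto simp: mult_le_cancel_right)
qed

section \<open>Hyperbolic distance along short paths\<close>

text \<open>The squared hyperbolic cosine of the hyperbolic distance of a and b.\<close>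

definition cosh_sq :: "complex \<Rightarrow> complex \<Rightarrow> real" where
  "cosh_sq a b = (cmod (1 - cnj a * b))\<^sup>2 / ((1 - (cmod a)\<^sup>2) * (1 - (cmod b)\<^sup>2))"

lemma cosh_sq_self:
  assumes "cmod a < 1"
  shows "cosh_sq a a = 1"
proof -
  have "0 < 1 - (cmod a)\<^sup>2"
    using assms by (simp add: abs_square_less_1)
  then show ?thesis
    using cmod_one_minus_cnj_mult_identity_1[of a a] one_minus_cnj_mult_nonzero[OF assms assms]
    by (simp add: cosh_sq_def)
qed

lemma abs_diff_cmod_square_le:
  assumes "cmod a \<le> 1" "cmod b \<le> 1"
  shows "\<bar>(cmod a)\<^sup>2 - (cmod b)\<^sup>2\<bar> \<le> 2 * cmod (a - b)"
proof -
  have "\<bar>(cmod a)\<^sup>2 - (cmod b)\<^sup>2\<bar> = (cmod a + cmod b) * \<bar>cmod a - cmod b\<bar>"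
    by (simp add: power2_eq_square square_diff_square_factored abs_mult)
  also have "\<dots> \<le> 2 * cmod (a - b)"
    using assms norm_triangle_ineq3[of a b] by (intro mult_mono) auto
  finally show ?thesis .
qed

text \<open>Since \<open>cmod (1 - cnj a * b)\<close> is at least half of
  \<open>1 - (cmod b)\<^sup>2\<close>, the move from \<open>b\<close> to \<open>c\<close> enlarges
  it by a factor of at most 4/3, hence its square by at most 16/9, rounded up to 2. The denominator
  keeps at least 2/3 of its value, and 2 / (2/3) = 3.\<close>

lemma cosh_sq_le_3_mult:
  assumes "cmod a < 1" "cmod b < 1" "cmod c < 1" and bc: "cmod (c - b) \<le> (1 - (cmod b)\<^sup>2) / 6"
  shows "cosh_sq a c \<le> 3 * cosh_sq a b"
proof -
  have pos: "0 < 1 - (cmod a)\<^sup>2" "0 < 1 - (cmod b)\<^sup>2" "0 < 1 - (cmod c)\<^sup>2"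
    using assms by (auto simp: abs_square_less_1)
  have "1 - cmod b \<le> 1 - cmod (cnj a * b)"
    using assms by (simp add: norm_mult mult_left_le_one_le)
  also have "\<dots> \<le> cmod (1 - cnj a * b)"
    using norm_triangle_ineq2[of 1 "cnj a * b"] by simp
  finally have "1 - cmod b \<le> cmod (1 - cnj a * b)" .
  moreover have "1 - (cmod b)\<^sup>2 \<le> 2 * (1 - cmod b)"
    using sum_squares_ge_zero[of "cmod b - 1" 0] by (simp add: power2_eq_square algebra_simps)
  ultimately have cb: "cmod (c - b) \<le> cmod (1 - cnj a * b) / 3"
    using bc by simp
  have "1 - cnj a * c = (1 - cnj a * b) - cnj a * (c - b)"
    by (simp add: algebra_simps)
  then have "cmod (1 - cnj a * c) \<le> cmod (1 - cnj a * b) + cmod (cnj a * (c - b))"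
    by (metis norm_triangle_ineq4)
  also have "cmod (cnj a * (c - b)) \<le> cmod (c - b)"
    using assms by (simp add: norm_mult mult_left_le_one_le)
  finally have "cmod (1 - cnj a * c) \<le> 4 / 3 * cmod (1 - cnj a * b)"
    using cb by simp
  then have "(cmod (1 - cnj a * c))\<^sup>2 \<le> (4 / 3 * cmod (1 - cnj a * b))\<^sup>2"
    by (intro power_mono) auto
  then have "(cmod (1 - cnj a * c))\<^sup>2 \<le> 16 / 9 * (cmod (1 - cnj a * b))\<^sup>2"
    by (simp add: power_mult_distrib power_divide)
  also have "\<dots> \<le> 2 * (cmod (1 - cnj a * b))\<^sup>2"
    by (intro mult_right_mono) auto
  finally have num: "(cmod (1 - cnj a * c))\<^sup>2 \<le> 2 * (cmod (1 - cnj a * b))\<^sup>2" .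
  have den: "2 / 3 * (1 - (cmod b)\<^sup>2) \<le> 1 - (cmod c)\<^sup>2"
    using abs_diff_cmod_square_le[OF less_imp_le less_imp_le, OF assms(3,2)] bc
    by (simp add: abs_le_iff)
  have "cosh_sq a c \<le> (2 * (cmod (1 - cnj a * b))\<^sup>2) / ((1 - (cmod a)\<^sup>2) * (2 / 3 * (1 - (cmod b)\<^sup>2)))"
    unfolding cosh_sq_def using num den pos by (intro frac_le mult_left_mono) auto
  also have "\<dots> = 3 * cosh_sq a b"
    by (simp add: cosh_sq_def del: right_diff_distrib_numeral)
  finally show ?thesis .
qed

text \<open>The path is cut into pieces of hyperbolic length at most 1/8, each of which multiplies
  \<open>cosh_sq\<close> by at most 3. A crude bound is enough, as long as it depends on the length
  only.\<close>

lemma cosh_sq_le_power_hyperbolic_length: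
  assumes \<gamma>: "path \<gamma>" "path_image \<gamma> \<subseteq> ball 0 1" and L: "has_hyperbolic_length \<gamma> L"
    and N: "L \<le> real N / 8" and t: "t \<in> {0..1}"
  shows "cosh_sq (\<gamma> 0) (\<gamma> t) \<le> 3 ^ Suc N"
proof -
  obtain g where g: "g absolutely_integrable_on {0..1}"
    and gint: "\<And>t. t \<in> {0..1} \<Longrightarrow> (g has_integral (\<gamma> t - \<gamma> 0)) {0..t}"
    and gL: "((\<lambda>t. norm (g t) / (1 - (norm (\<gamma> t))\<^sup>2)) has_integral L) {0..1}"
    using L unfolding has_hyperbolic_length_def by blast
  define h where "h t = norm (g t) / (1 - (norm (\<gamma> t))\<^sup>2)" for t
  define len where "len t = integral {0..t} h" for t
  have hint: "h integrable_on {0..1}" and hL: "integral {0..1} h = L"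
    using gL unfolding h_def by (auto simp: has_integral_iff)
  have g1: "g integrable_on {0..1}"
    using g by (rule set_lebesgue_integral_eq_integral)
  have norm1: "cmod (\<gamma> u) < 1" if "u \<in> {0..1}" for u
    using \<gamma>(2) that unfolding path_image_def by force
  have pos: "0 < 1 - (cmod (\<gamma> u))\<^sup>2" if "u \<in> {0..1}" for u
    using norm1[OF that] by (simp add: abs_square_less_1)
  have h0: "0 \<le> h u" if "u \<in> {0..1}" for u
    using pos[OF that] by (simp add: h_def)
  have cont\<gamma>: "continuous_on {0..1} \<gamma>"
    using \<gamma>(1) by (simp add: path_def)
  have hsub: "h integrable_on {u..v}" and gsub: "g integrable_on {u..v}" if "0 \<le> u" "v \<le> 1" for u v
    using that hint g1 by (auto intro: integrable_on_subinterval)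
  have lendiff: "integral {u..v} h = len v - len u" if "0 \<le> u" "u \<le> v" "v \<le> 1" for u v
    using Henstock_Kurzweil_Integration.integral_combine[where a=0 and c=u and b=v and f=h] that hsub[of 0 v] by (simp add: len_def)
  have \<gamma>diff: "integral {u..v} g = \<gamma> v - \<gamma> u" if "0 \<le> u" "u \<le> v" "v \<le> 1" for u v
  proof -
    have "integral {0..u} g = \<gamma> u - \<gamma> 0" "integral {0..v} g = \<gamma> v - \<gamma> 0"
      using that gint by (auto intro!: integral_unique)
    moreover have "integral {0..u} g + integral {u..v} g = integral {0..v} g"
      using that gsub by (intro Henstock_Kurzweil_Integration.integral_combine) auto
    ultimately show ?thesis by algebra
  qed
  have lenmono: "len u \<le> len v" if "0 \<le> u" "u \<le> v" "v \<le> 1" for u v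
    using lendiff[OF that] integral_nonneg[of h "{u..v}"] h0 hsub[of u v] that by force
  have step: "cosh_sq (\<gamma> 0) (\<gamma> v) \<le> 3 * cosh_sq (\<gamma> 0) (\<gamma> u)"
    if uv: "0 \<le> u" "u \<le> v" "v \<le> 1" "len v - len u \<le> 1/8" for u v
  proof -
    have sub: "{u..v} \<subseteq> {0..1}" using uv by auto
    have "continuous_on {u..v} (\<lambda>s. 1 - (cmod (\<gamma> s))\<^sup>2)"
      using continuous_on_subset[OF cont\<gamma> sub] by (intro continuous_intros)
    then obtain m where m: "m \<in> {u..v}" "\<And>s. s \<in> {u..v} \<Longrightarrow> 1 - (cmod (\<gamma> s))\<^sup>2 \<le> 1 - (cmod (\<gamma> m))\<^sup>2"
      using continuous_attains_sup[of "{u..v}" "\<lambda>s. 1 - (cmod (\<gamma> s))\<^sup>2"] uv(2) by force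
    \<comment> \<open>The hyperbolic density on the piece is at least \<open>1 / M\<close>, so
      hyperbolic length at most 1/8 forces Euclidean displacements of at most
      \<open>M / 8\<close>.\<close>
    define M where "M = 1 - (cmod (\<gamma> m))\<^sup>2"
    have M0: "0 < M" using pos m sub unfolding M_def by blast
    have close: "cmod (\<gamma> s' - \<gamma> s) \<le> M / 8" if s: "u \<le> s" "s \<le> s'" "s' \<le> v" for s s'
    proof -
      have "cmod (integral {s..s'} g) \<le> integral {s..s'} (\<lambda>x. M * h x)"
      proof (rule Henstock_Kurzweil_Integration.integral_norm_bound_integral)
        show "g integrable_on {s..s'}" using s uv by (intro gsub) auto
        show "(\<lambda>x. M * h x) integrable_on {s..s'}"
          using s uv by (intro integrable_on_mult_right hsub) auto
        fix x assume x: "x \<in> {s..s'}"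
        then have "0 < 1 - (cmod (\<gamma> x))\<^sup>2" "1 - (cmod (\<gamma> x))\<^sup>2 \<le> M"
          using s uv pos[of x] m(2)[of x] by (auto simp: M_def)
        moreover from this have "cmod (g x) * (1 - (cmod (\<gamma> x))\<^sup>2) \<le> cmod (g x) * M"
          by (intro mult_left_mono) auto
        ultimately show "cmod (g x) \<le> M * h x"
          by (simp add: h_def pos_le_divide_eq mult.commute)
      qed
      also have "\<dots> = M * (len s' - len s)"
        using lendiff[of s s'] s uv by simp
      also have "\<dots> \<le> M * (1/8)"
        using M0 lenmono[of u s] lenmono[of s' v] s uv by (intro mult_left_mono) auto
      finally show ?thesis using \<gamma>diff[of s s'] s uv by simp
    qed
    \<comment> \<open>Moving from \<open>m\<close> to \<open>u\<close> lowers \<open>M\<close> by at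
      most \<open>M / 4\<close>; then \<open>M / 8\<close> is at most one sixth of the value at
      \<open>u\<close>, as the previous lemma requires.\<close>
    have "\<bar>(cmod (\<gamma> m))\<^sup>2 - (cmod (\<gamma> u))\<^sup>2\<bar> \<le> 2 * cmod (\<gamma> m - \<gamma> u)"
      using norm1[of m] norm1[of u] m uv by (intro abs_diff_cmod_square_le) auto
    then have "3 / 4 * M \<le> 1 - (cmod (\<gamma> u))\<^sup>2"
      using close[of u m] m uv by (auto simp: M_def)
    then have "cmod (\<gamma> v - \<gamma> u) \<le> (1 - (cmod (\<gamma> u))\<^sup>2) / 6"
      using close[of u v] uv by simp
    then show ?thesis
      using uv by (intro cosh_sq_le_3_mult norm1) auto
  qed
  have len0: "len 0 = 0" by (simp add: len_def)
  have lent: "len t \<le> real N / 8"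
    using lenmono[of t 1] t N hL by (auto simp: len_def)
  \<comment> \<open>Induction on the number of pieces. The exponent \<open>Suc k\<close> lets the
    case of length 0 be settled by one application of \<open>step\<close>; later cases cut where the
    length is exactly \<open>k / 8\<close>.\<close>
  have "\<forall>t\<in>{0..1}. len t \<le> real k / 8 \<longrightarrow> cosh_sq (\<gamma> 0) (\<gamma> t) \<le> 3 ^ Suc k" for k
  proof (induction k)
    case 0
    show ?case using step[of 0] cosh_sq_self[OF norm1[of 0]] len0 by auto
  next
    case (Suc k)
    show ?case
    proof (intro ballI impI)
      fix t :: real assume t: "t \<in> {0..1}" "len t \<le> real (Suc k) / 8"
      show "cosh_sq (\<gamma> 0) (\<gamma> t) \<le> 3 ^ Suc (Suc k)"
      proof (cases "len t \<le> real k / 8")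
        case True
        then have "cosh_sq (\<gamma> 0) (\<gamma> t) \<le> 3 ^ Suc k" using Suc t by blast
        also have "\<dots> \<le> 3 ^ Suc (Suc k)" by simp
        finally show ?thesis .
      next
        case False
        have "continuous_on {0..t} len"
          unfolding len_def using t by (intro indefinite_integral_continuous_1 hsub) auto
        then obtain s where s: "0 \<le> s" "s \<le> t" "len s = real k / 8"
          using IVT'[of len 0 "real k / 8" t] False t len0 by auto
        have "cosh_sq (\<gamma> 0) (\<gamma> t) \<le> 3 * cosh_sq (\<gamma> 0) (\<gamma> s)"
          using s t by (intro step) (auto simp: field_simps)
        also have "\<dots> \<le> 3 * 3 ^ Suc k"
          using Suc s t by (intro mult_left_mono) auto
        finally show ?thesis by simp
      qed
    qed
  qed
  then show ?thesis using t lent by blast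
qed

text \<open>The numerator of \<open>cosh_sq\<close> is at least the square of
  \<open>1 - cmod a\<close>, and that is at least half of \<open>1 - (cmod a)\<^sup>2\<close>. So a
  point within bounded distance of \<open>a\<close> cannot be much closer to the unit circle than
  \<open>a\<close>.\<close>

lemma one_minus_cmod_square_ge_cosh_sq:
  assumes "cmod a < 1" "cmod b < 1" "cosh_sq a b \<le> Q"
  shows "1 - (cmod a)\<^sup>2 \<le> 4 * Q * (1 - (cmod b)\<^sup>2)"
proof -
  have pos: "0 < 1 - (cmod a)\<^sup>2" "0 < 1 - (cmod b)\<^sup>2"
    using assms by (auto simp: abs_square_less_1)
  have "(1 - (cmod a)\<^sup>2) / 2 \<le> 1 - cmod a"
    using sum_squares_ge_zero[of "cmod a - 1" 0] by (simp add: power2_eq_square field_simps)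
  also have "1 - cmod a \<le> 1 - cmod (cnj a * b)"
    using assms by (simp add: norm_mult mult_right_le_one_le)
  also have "\<dots> \<le> cmod (1 - cnj a * b)"
    using norm_triangle_ineq2[of 1 "cnj a * b"] by simp
  finally have "((1 - (cmod a)\<^sup>2) / 2)\<^sup>2 \<le> (cmod (1 - cnj a * b))\<^sup>2"
    using pos by (intro power_mono) auto
  also have "\<dots> \<le> Q * ((1 - (cmod a)\<^sup>2) * (1 - (cmod b)\<^sup>2))"
    using assms pos by (simp add: cosh_sq_def divide_le_eq)
  finally have "(1 - (cmod a)\<^sup>2) * (1 - (cmod a)\<^sup>2) \<le> (4 * Q * (1 - (cmod b)\<^sup>2)) * (1 - (cmod a)\<^sup>2)"
    by (simp add: power_divide power2_eq_square[of "1 - (cmod a)\<^sup>2"] mult_ac del: right_diff_distrib_numeral)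
  then show ?thesis using pos by (simp add: mult_le_cancel_right)
qed

text \<open>The pseudo-hyperbolic distance is the hyperbolic tangent of the distance, so this is
  \<open>tanh^2 = 1 - 1 / cosh^2\<close>.\<close>

lemma pseudo_hyperbolic_square:
  assumes "cmod a < 1" "cmod b < 1"
  shows "(cmod ((b - a) / (1 - cnj a * b)))\<^sup>2 = 1 - 1 / cosh_sq a b"
proof -
  have "(cmod (1 - cnj a * b))\<^sup>2 \<noteq> 0"
    using one_minus_cnj_mult_nonzero[OF assms] by simp
  then show ?thesis
    unfolding cosh_sq_def norm_divide power_divide cmod_one_minus_cnj_mult_identity_1
    by (simp add: field_simps)
qed

text \<open>This bounds the contraction factor of an omitted value uniformly by its value at the
  largest distance allowed. In terms of the square roots \<open>u\<close> and \<open>v\<close> it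
  amounts to \<open>(v - u) * (1 - u * v) \<ge> 0\<close>.\<close>

lemma two_sqrt_div_mono:
  fixes x y :: real
  assumes "0 \<le> x" "x \<le> y" "y \<le> 1"
  shows "2 * sqrt x / (1 + x) \<le> 2 * sqrt y / (1 + y)"
proof -
  define u v where "u = sqrt x" and "v = sqrt y"
  have uv: "0 \<le> u" "u \<le> v" "v \<le> 1" "x = u\<^sup>2" "y = v\<^sup>2"
    using assms by (auto simp: u_def v_def)
  have "u * v \<le> 1" using uv by (simp add: mult_le_one)
  then have "0 \<le> (v - u) * (1 - u * v)" using uv by simp
  then have "2 * u * (1 + v\<^sup>2) \<le> 2 * v * (1 + u\<^sup>2)"
    by (simp add: algebra_simps power2_eq_square)
  then have "2 * u / (1 + u\<^sup>2) \<le> 2 * v / (1 + v\<^sup>2)"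
    using add_pos_nonneg[OF zero_less_one zero_le_power2[of u]] add_pos_nonneg[OF zero_less_one zero_le_power2[of v]]
    by (simp add: pos_divide_le_eq pos_le_divide_eq mult_ac)
  then show ?thesis unfolding u_def[symmetric] v_def[symmetric] using uv(4,5) by simp
qed

section \<open>The closed curve and positivity of the conformal radius\<close>

lemma concat_paths_loop:
  assumes "\<And>i. i < Suc n \<Longrightarrow> path (\<gamma> i) \<and> pathstart (\<gamma> i) = z i \<and> pathfinish (\<gamma> i) = z (Suc i)"
  shows "path (concat_paths \<gamma> (Suc n)) \<and> pathstart (concat_paths \<gamma> (Suc n)) = z 0 \<and>
    pathfinish (concat_paths \<gamma> (Suc n)) = z (Suc n) \<and>
    path_image (concat_paths \<gamma> (Suc n)) = (\<Union>i\<le>n. path_image (\<gamma> i))"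
  using assms
proof (induction n)
  case 0
  then show ?case by (simp add: concat_paths_def)
next
  case (Suc n)
  have "concat_paths \<gamma> (Suc (Suc n)) = concat_paths \<gamma> (Suc n) +++ \<gamma> (Suc n)"
    by (simp add: concat_paths_def)
  moreover have "path (\<gamma> (Suc n)) \<and> pathstart (\<gamma> (Suc n)) = z (Suc n) \<and> pathfinish (\<gamma> (Suc n)) = z (Suc (Suc n))"
    using Suc.prems by simp
  moreover have "path (concat_paths \<gamma> (Suc n)) \<and> pathstart (concat_paths \<gamma> (Suc n)) = z 0 \<and>
    pathfinish (concat_paths \<gamma> (Suc n)) = z (Suc n) \<and>
    path_image (concat_paths \<gamma> (Suc n)) = (\<Union>i\<le>n. path_image (\<gamma> i))"
    using Suc.prems by (intro Suc.IH) simp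
  ultimately show ?case
    by (auto simp: path_image_join atMost_Suc)
qed

text \<open>A covering map is injective near 0, and an injective holomorphic map has nonzero
  derivative. Positivity is what allows \<open>ln\<close> to be applied to bounds on the
  radius.\<close>

lemma is_conformal_radius_pos:
  assumes "is_conformal_radius V r" "open V"
  shows "r > 0"
proof -
  obtain \<phi> where \<phi>: "\<phi> holomorphic_on ball 0 1" "covering_space (ball 0 1) \<phi> V" "r = norm (deriv \<phi> 0)"
    using assms(1) unfolding is_conformal_radius_def by blast
  obtain T u q where T: "0 \<in> T" "openin (top_of_set (ball 0 1)) T" "homeomorphism T u \<phi> q"
    using covering_space_local_homeomorphism[OF \<phi>(2), of 0] by (metis centre_in_ball zero_less_one)
  have "open T" using T(2) by (metis open_ball openin_open_eq)
  moreover have "inj_on \<phi> T" using T(3) unfolding homeomorphism_def by (metis inj_on_def)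
  moreover have "\<phi> holomorphic_on T"
    using \<phi>(1) T(2) by (meson holomorphic_on_subset openin_imp_subset)
  ultimately have "deriv \<phi> 0 \<noteq> 0"
    using holomorphic_injective_imp_regular T(1) by blast
  then show ?thesis using \<phi>(3) by simp
qed

section \<open>The derivative bound from a winding curve\<close>

text \<open>The maximum principle is applied to \<open>\<phi> / R\<close> with \<open>R < 1\<close>,
  over the region of nonzero winding number, which contains 0. On the curve bounding it, the factor
  \<kappa> pays for the smaller target disc; at the origin the conclusion is that
  \<open>\<phi>\<close> has derivative at most \<open>R\<close> in modulus.\<close>

lemma norm_deriv_le_of_winding_curve:
  fixes \<phi> :: "complex \<Rightarrow> complex"
  assumes hol: "\<phi> holomorphic_on ball 0 1" and \<phi>0: "\<phi> 0 = 0"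
    and p: "path p" "pathfinish p = pathstart p" "0 \<notin> path_image p" "winding_number p 0 \<noteq> 0"
    and \<kappa>: "0 < \<kappa>" "\<kappa> < 1" and m: "0 < m" "m < 1"
    and pm: "\<And>x. x \<in> path_image p \<Longrightarrow> m \<le> 1 - (cmod x)\<^sup>2"
    and contr: "\<And>w. cmod w < 1 \<Longrightarrow> \<phi> w \<in> path_image p \<Longrightarrow>
      cmod (deriv \<phi> w) * (1 - (cmod w)\<^sup>2) \<le> \<kappa> * (1 - (cmod (\<phi> w))\<^sup>2)"
  shows "(cmod (deriv \<phi> 0))\<^sup>2 \<le> 1 - (1 - \<kappa>) * m"
proof -
  \<comment> \<open>Chosen so that \<open>\<kappa> * (1 - s) \<le> R\<^sup>2 - s\<close> holds
    exactly when \<open>1 - s\<close> is at least \<open>m\<close>; here \<open>s\<close> is the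
    squared modulus of a point of the curve.\<close>
  define R where "R = sqrt (1 - (1 - \<kappa>) * m)"
  have "(1 - \<kappa>) * m < 1 * 1"
    using \<kappa> m by (intro mult_strict_mono) auto
  then have R0: "0 < R" and R2: "R\<^sup>2 = 1 - (1 - \<kappa>) * m"
    by (auto simp: R_def)
  have R1: "R \<le> 1" using \<kappa> m by (simp add: R_def)
  \<comment> \<open>Level sets of the winding number are open, so \<open>U\<close> is open as a
    union of them, and \<open>C\<close>, which adds the curve, is closed as the complement of
    one.\<close>
  define U where "U = (\<Union>k\<in>-{0}. {z. z \<notin> path_image p \<and> winding_number p z = k})"
  define C where "C = - {z. z \<notin> path_image p \<and> winding_number p z = 0}"
  have UC: "U \<subseteq> C" "C - U \<subseteq> path_image p" by (auto simp: U_def C_def)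
  have "open U" unfolding U_def using open_winding_number_levelsets[OF p(1,2)] by blast
  have "closed C" unfolding C_def using open_winding_number_levelsets[OF p(1,2)] by blast
  \<comment> \<open>The curve lies in a closed disc, and by convexity the winding number vanishes
    outside it.\<close>
  have Cm: "m \<le> 1 - (cmod z)\<^sup>2" if "z \<in> C" for z
  proof -
    have sub: "path_image p \<subseteq> cball 0 (sqrt (1 - m))"
      using pm by (force intro: real_le_rsqrt)
    have "z \<in> cball 0 (sqrt (1 - m))"
      using winding_number_zero_outside[OF p(1) convex_cball p(2) _ sub] that sub by (auto simp: C_def)
    then have "(cmod z)\<^sup>2 \<le> (sqrt (1 - m))\<^sup>2" by (intro power_mono) auto
    then show ?thesis using m by simp
  qed
  have CR: "cmod z < R" if "z \<in> C" for z
  proof -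
    have "(cmod z)\<^sup>2 \<le> 1 - m" using Cm[OF that] by simp
    also have "\<dots> < R\<^sup>2" using \<kappa> m by (simp add: R2 algebra_simps)
    finally show ?thesis using R0 by (simp add: power_less_imp_less_base)
  qed
  define f where "f w = \<phi> w / of_real R" for w
  have holf: "f holomorphic_on ball 0 1"
    unfolding f_def using hol R0 by (intro holomorphic_intros) auto
  have df: "deriv f w = deriv \<phi> w / of_real R" if "cmod w < 1" for w
    unfolding f_def
    using hol that by (intro deriv_cdivide_right holomorphic_on_imp_differentiable_at[of _ "ball 0 1"]) auto
  have scale: "of_real R * f w = \<phi> w" for w using R0 by (simp add: f_def)
  have nf: "cmod (f w) = cmod (\<phi> w) / R" for w using R0 by (simp add: f_def norm_divide)
  have "cmod (deriv f 0) * (1 - (cmod 0)\<^sup>2) \<le> 1 - (cmod (f 0))\<^sup>2"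
  proof (rule hyperbolic_derivative_le_1[OF holf])
    show "open ((\<lambda>z. of_real R * z) -` U)" "closed ((\<lambda>z. of_real R * z) -` C)"
      using \<open>open U\<close> \<open>closed C\<close> by (auto intro!: continuous_open_vimage continuous_closed_vimage continuous_intros)
    show "(\<lambda>z. of_real R * z) -` U \<subseteq> (\<lambda>z. of_real R * z) -` C" using UC by blast
    show "f 0 \<in> (\<lambda>z. of_real R * z) -` C"
      using p \<phi>0 by (simp add: scale C_def)
  next
    fix w assume w: "cmod w < 1" "f w \<in> (\<lambda>z. of_real R * z) -` C"
    then show "cmod (f w) < 1"
      using CR[of "\<phi> w"] R0 by (simp add: scale nf)
  next
    fix w assume w: "cmod w < 1" "f w \<in> (\<lambda>z. of_real R * z) -` C - (\<lambda>z. of_real R * z) -` U"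
    then have "\<phi> w \<in> C - U" by (simp add: scale)
    then have 1: "cmod (deriv \<phi> w) * (1 - (cmod w)\<^sup>2) \<le> \<kappa> * (1 - (cmod (\<phi> w))\<^sup>2)"
      and 2: "m \<le> 1 - (cmod (\<phi> w))\<^sup>2"
      using contr w UC Cm by auto
    \<comment> \<open>Multiplied by \<open>R\<^sup>2\<close>, the goal for \<open>f\<close> becomes
      the inequality \<open>3\<close> for \<open>\<phi>\<close>; it follows from
      \<open>R \<le> 1\<close> and the choice of \<open>R\<close>.\<close>
    have "R * (\<kappa> * (1 - (cmod (\<phi> w))\<^sup>2)) \<le> 1 * (\<kappa> * (1 - (cmod (\<phi> w))\<^sup>2))"
      using R1 \<kappa> m 2 by (intro mult_right_mono) auto
    also have "\<dots> \<le> R\<^sup>2 - (cmod (\<phi> w))\<^sup>2"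
      using mult_left_mono[OF 2, of "1 - \<kappa>"] \<kappa> by (simp add: R2 algebra_simps)
    finally have 3: "R * (cmod (deriv \<phi> w) * (1 - (cmod w)\<^sup>2)) \<le> R\<^sup>2 - (cmod (\<phi> w))\<^sup>2"
      using mult_left_mono[OF 1, of R] R0 by linarith
    have "cmod (deriv f w) * (1 - (cmod w)\<^sup>2) = R * (cmod (deriv \<phi> w) * (1 - (cmod w)\<^sup>2)) / R\<^sup>2"
      using R0 by (simp add: df[OF w(1)] norm_divide power2_eq_square)
    also have "\<dots> \<le> (R\<^sup>2 - (cmod (\<phi> w))\<^sup>2) / R\<^sup>2"
      using 3 by (intro divide_right_mono) auto
    also have "\<dots> = 1 - (cmod (f w))\<^sup>2"
      using R0 by (simp add: nf power_divide diff_divide_distrib)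
    finally show "cmod (deriv f w) * (1 - (cmod w)\<^sup>2) \<le> 1 - (cmod (f w))\<^sup>2" .
  qed auto
  then have "cmod (deriv \<phi> 0) \<le> R"
    using R0 \<phi>0 by (simp add: df norm_divide f_def)
  then have "(cmod (deriv \<phi> 0))\<^sup>2 \<le> R\<^sup>2" by (intro power_mono) auto
  then show ?thesis by (simp add: R2)
qed

section \<open>The uniform constant and the final estimate\<close>

text \<open>\<open>b2\<close> stays bounded away from 0 as \<rho> tends to 0, and \<open>b1\<close>
  is void for \<rho> near 1, so the cases split at 1/16. Below it, \<open>b1\<close> gives
  \<open>ln r \<le> ln \<rho> / 4\<close>. Above it, \<open>- ln \<rho>\<close> is at most
  \<open>16 * (1 - \<rho>\<^sup>2)\<close>, and the square in \<open>b2\<close> doubles 16 to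
  32.\<close>

lemma ln_le_of_two_bounds:
  fixes r \<rho> \<eta> :: real
  assumes r: "0 < r" and \<rho>: "0 < \<rho>" "\<rho> < 1" and \<eta>: "0 < \<eta>" "\<eta> < 1"
    and b1: "r \<le> 2 * sqrt \<rho>" and b2: "r\<^sup>2 \<le> 1 - \<eta> * (1 - \<rho>\<^sup>2)"
  shows "ln r \<le> ln \<rho> / (32 / \<eta>)"
proof (cases "\<rho> \<le> 1/16")
  case True
  have "ln \<rho> \<le> ln (inverse (2 ^ 4))"
    using True \<rho> by (subst ln_le_cancel_iff) auto
  also have "\<dots> = - 4 * ln 2"
    by (subst ln_inverse, subst ln_realpow) auto
  finally have "ln 2 \<le> - ln \<rho> / 4" by simp
  moreover have "ln r \<le> ln (2 * sqrt \<rho>)"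
    using b1 r by (subst ln_le_cancel_iff) (use \<rho> in auto)
  moreover have "ln (2 * sqrt \<rho>) = ln 2 + ln \<rho> / 2"
    using \<rho> by (simp add: ln_mult ln_sqrt)
  moreover have "ln \<rho> / 4 \<le> ln \<rho> * (\<eta> / 32)"
    using mult_left_mono_neg[of "\<eta>/32" "1/4" "ln \<rho>"] \<rho> \<eta> by simp
  ultimately show ?thesis by simp
next
  case False
  have "2 * ln r = ln (r\<^sup>2)" using r by (simp add: ln_realpow)
  also have "\<dots> \<le> r\<^sup>2 - 1" using r by (intro ln_le_minus_one) auto
  also have "\<dots> \<le> - (\<eta> * (1 - \<rho>\<^sup>2))" using b2 by simp
  finally have 1: "2 * ln r \<le> - (\<eta> * (1 - \<rho>\<^sup>2))" .
  have "- ln \<rho> = ln (1/\<rho>)" using \<rho> by (simp add: ln_div)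
  also have "\<dots> \<le> 1/\<rho> - 1" using \<rho> by (intro ln_le_minus_one) auto
  also have "\<dots> = (1 - \<rho>) * (1/\<rho>)" using \<rho> by (simp add: field_simps)
  also have "\<dots> \<le> (1 - \<rho>) * 16"
    using False \<rho> by (intro mult_left_mono) (auto simp: field_simps)
  also have "\<dots> \<le> 16 * (1 - \<rho>\<^sup>2)"
    using \<rho> by (simp add: power2_eq_square)
  finally have "\<eta> * (- ln \<rho>) \<le> \<eta> * (16 * (1 - \<rho>\<^sup>2))"
    using \<eta> by (intro mult_left_mono) auto
  then show ?thesis using 1 \<eta> by (simp add: field_simps)
qed

theorem mainTheorem2:
  fixes d :: real
  assumes "d > 0"
  shows "\<exists>K>1. \<forall>(n::nat) (z :: nat \<Rightarrow> complex) (\<gamma> :: nat \<Rightarrow> real \<Rightarrow> complex) (r' :: real).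
           n \<ge> 1 \<longrightarrow>
           (\<forall>i\<le>n. z i \<in> ball 0 1 - {0}) \<longrightarrow>
           z n = z 0 \<longrightarrow>
           (\<forall>i<n. path (\<gamma> i) \<and> pathstart (\<gamma> i) = z i \<and> pathfinish (\<gamma> i) = z (Suc i) \<and>
                  path_image (\<gamma> i) \<subseteq> ball 0 1 - {0} \<and>
                  (\<exists>L\<le>d. has_hyperbolic_length (\<gamma> i) L)) \<longrightarrow>
           winding_number (concat_paths \<gamma> n) 0 \<noteq> 0 \<longrightarrow>
           is_conformal_radius (ball 0 1 - z ` {1..n}) r' \<longrightarrow>
           ln r' \<le> ln (Max ((\<lambda>i. norm (z i)) ` {1..n})) / K \<and>
           ln (Max ((\<lambda>i. norm (z i)) ` {1..n})) / K < 0"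
proof -
  obtain N :: nat where "d * 8 \<le> real N"
    using real_arch_simple by blast
  then have N: "d \<le> real N / 8" by simp
  \<comment> \<open>\<open>Q\<close> bounds \<open>cosh_sq\<close> along paths of length at most
    \<open>d\<close>, \<delta> is the corresponding pseudo-hyperbolic distance, and \<kappa> is the
    contraction factor at that distance from an omitted point.\<close>
  define Q :: real where "Q = 3 ^ Suc N"
  have Q: "1 < Q" unfolding Q_def by (rule one_less_power) auto
  define \<delta> where "\<delta> = sqrt (1 - 1 / Q)"
  have \<delta>: "0 < \<delta>" "\<delta> < 1" using Q by (auto simp: \<delta>_def)
  define \<kappa> where "\<kappa> = 2 * sqrt \<delta> / (1 + \<delta>)"
  have \<kappa>: "0 < \<kappa>" "\<kappa> < 1"
  proof -
    show "0 < \<kappa>" using \<delta> by (simp add: \<kappa>_def)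
    have "0 < (1 - sqrt \<delta>)\<^sup>2" using \<delta> by simp
    then show "\<kappa> < 1" using \<delta> by (simp add: \<kappa>_def power2_diff)
  qed
  \<comment> \<open>On the curve \<open>1 - (cmod x)\<^sup>2\<close> is at least
    \<open>m = (1 - \<rho>\<^sup>2) / (4 * Q)\<close>, and \<open>(1 - \<kappa>) * m\<close> is then
    \<open>\<eta> * (1 - \<rho>\<^sup>2)\<close>.\<close>
  define \<eta> where "\<eta> = (1 - \<kappa>) / (4 * Q)"
  have \<eta>: "0 < \<eta>" "\<eta> < 1" using \<kappa> Q by (auto simp: \<eta>_def)
  have K1: "1 < 32 / \<eta>" using \<eta> by simp
  have bound: "ln r' \<le> ln (Max ((\<lambda>i. norm (z i)) ` {1..n})) / (32 / \<eta>) \<and>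
           ln (Max ((\<lambda>i. norm (z i)) ` {1..n})) / (32 / \<eta>) < 0"
    if n: "n \<ge> 1" and z: "\<forall>i\<le>n. z i \<in> ball 0 1 - {0}" and zn: "z n = z 0"
      and \<gamma>: "\<forall>i<n. path (\<gamma> i) \<and> pathstart (\<gamma> i) = z i \<and> pathfinish (\<gamma> i) = z (Suc i) \<and>
                  path_image (\<gamma> i) \<subseteq> ball 0 1 - {0} \<and> (\<exists>L\<le>d. has_hyperbolic_length (\<gamma> i) L)"
      and wn: "winding_number (concat_paths \<gamma> n) 0 \<noteq> 0"
      and r': "is_conformal_radius (ball 0 1 - z ` {1..n}) r'"
    for n and z :: "nat \<Rightarrow> complex" and \<gamma> :: "nat \<Rightarrow> real \<Rightarrow> complex" and r' :: real
  proof -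
    define \<rho> where "\<rho> = Max ((\<lambda>i. norm (z i)) ` {1..n})"
    have "\<rho> \<in> (\<lambda>i. norm (z i)) ` {1..n}"
      unfolding \<rho>_def using n by (intro Max_in) auto
    then obtain j where j: "j \<in> {1..n}" "\<rho> = norm (z j)" by auto
    have \<rho>: "0 < \<rho>" "\<rho> < 1" using z j by auto
    \<comment> \<open>Paths start at indices 0 to \<open>n - 1\<close> while the omitted points have
      indices 1 to \<open>n\<close>; \<open>z n = z 0\<close> reconciles the two.\<close>
    have zZ: "z i \<in> z ` {1..n}" if "i < n" for i
      using that n zn imageI[of n "{1..n}" z] imageI[of i "{1..n}" z] by (cases "i = 0") auto
    have z\<rho>: "norm (z i) \<le> \<rho>" if "i < n" for i
      unfolding \<rho>_def using zZ[OF that] by (intro Max_ge) auto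
    obtain \<phi> where hol: "\<phi> holomorphic_on ball 0 1" and cov: "covering_space (ball 0 1) \<phi> (ball 0 1 - z ` {1..n})"
      and \<phi>0: "\<phi> 0 = 0" and r: "r' = norm (deriv \<phi> 0)"
      using r' unfolding is_conformal_radius_def by blast
    have im: "\<phi> ` ball 0 1 = ball 0 1 - z ` {1..n}"
      using cov by (rule covering_space_imp_surjective)
    have im1: "cmod (\<phi> u) < 1" if "cmod u < 1" for u
      using im that by (force simp: set_eq_iff)
    have omit: "z i \<notin> \<phi> ` ball 0 1" if "i \<in> {1..n}" for i
      using im that by auto
    have rpos: "0 < r'"
      using r' by (rule is_conformal_radius_pos) (auto intro!: open_Diff finite_imp_closed)
    obtain n' where n': "n = Suc n'" using n by (cases n) auto
    let ?p = "concat_paths \<gamma> n"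
    have p: "path ?p" "pathfinish ?p = pathstart ?p" "path_image ?p = (\<Union>i\<le>n'. path_image (\<gamma> i))"
      using concat_paths_loop[of n' \<gamma> z] \<gamma> zn unfolding n' by auto
    have near: "\<exists>i<n. cosh_sq (z i) x \<le> Q \<and> cmod x < 1" if x: "x \<in> path_image ?p" for x
    proof -
      obtain i t where i: "i < n" "t \<in> {0..1}" "x = \<gamma> i t"
        using x unfolding p(3) path_image_def[of "\<gamma> _"] by (auto simp: n' less_Suc_eq_le)
      obtain L where L: "L \<le> d" "has_hyperbolic_length (\<gamma> i) L" using \<gamma> i by blast
      have "cosh_sq (\<gamma> i 0) (\<gamma> i t) \<le> 3 ^ Suc N"
        using \<gamma> i L N by (intro cosh_sq_le_power_hyperbolic_length[of "\<gamma> i" L]) auto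
      moreover have "\<gamma> i 0 = z i" using \<gamma> i by (auto simp: pathstart_def)
      moreover have "cmod x < 1" using \<gamma> i unfolding path_image_def by force
      ultimately show ?thesis using i by (auto simp: Q_def)
    qed
    have "(cmod (deriv \<phi> 0))\<^sup>2 \<le> 1 - (1 - \<kappa>) * ((1 - \<rho>\<^sup>2) / (4 * Q))"
    proof (rule norm_deriv_le_of_winding_curve[OF hol \<phi>0 p(1,2) _ wn \<kappa>])
      show "0 \<notin> path_image ?p" using \<gamma> unfolding p(3) by (auto simp: n' less_Suc_eq_le)
      have "0 < 1 - \<rho>\<^sup>2" "1 - \<rho>\<^sup>2 < 4 * Q"
        using \<rho> Q zero_le_power2[of \<rho>] by (simp add: abs_square_less_1, linarith)
      then show "0 < (1 - \<rho>\<^sup>2) / (4 * Q)" "(1 - \<rho>\<^sup>2) / (4 * Q) < 1"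
        using Q by (simp_all add: pos_divide_less_eq)
      fix x assume x: "x \<in> path_image ?p"
      obtain i where i: "i < n" "cosh_sq (z i) x \<le> Q" "cmod x < 1" using near[OF x] by blast
      have "1 - (cmod (z i))\<^sup>2 \<le> 4 * Q * (1 - (cmod x)\<^sup>2)"
        using i z by (intro one_minus_cmod_square_ge_cosh_sq) auto
      moreover have "(cmod (z i))\<^sup>2 \<le> \<rho>\<^sup>2" using z\<rho>[OF i(1)] by (intro power_mono) auto
      ultimately show "(1 - \<rho>\<^sup>2) / (4 * Q) \<le> 1 - (cmod x)\<^sup>2"
        using Q by (simp add: pos_divide_le_eq mult_ac)
    next
      fix w assume w: "cmod w < 1" "\<phi> w \<in> path_image ?p"
      obtain i where i: "i < n" "cosh_sq (z i) (\<phi> w) \<le> Q" "cmod (\<phi> w) < 1" using near[OF w(2)] by blast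
      define x where "x = cmod ((\<phi> w - z i) / (1 - cnj (z i) * \<phi> w))"
      have zi: "cmod (z i) < 1" using z i by auto
      have "x\<^sup>2 = 1 - 1 / cosh_sq (z i) (\<phi> w)"
        unfolding x_def by (rule pseudo_hyperbolic_square[OF zi i(3)])
      moreover have "0 < cosh_sq (z i) (\<phi> w)"
        using one_minus_cnj_mult_nonzero[OF zi i(3)] zi i(3) by (simp add: cosh_sq_def abs_square_less_1)
      ultimately have "x\<^sup>2 \<le> 1 - 1 / Q"
        using i(2) by (simp add: frac_le)
      then have "x \<le> \<delta>" unfolding \<delta>_def by (rule real_le_rsqrt)
      moreover have x0: "0 \<le> x" by (simp add: x_def)
      ultimately have "2 * sqrt x / (1 + x) \<le> \<kappa>"
        unfolding \<kappa>_def using \<delta> by (intro two_sqrt_div_mono) auto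
      moreover have "0 < 1 - (cmod (\<phi> w))\<^sup>2" using i(3) by (simp add: abs_square_less_1)
      moreover have "cmod (deriv \<phi> w) * (1 - (cmod w)\<^sup>2) * (1 + x) \<le> 2 * sqrt x * (1 - (cmod (\<phi> w))\<^sup>2)"
        unfolding x_def using zZ[OF i(1)] im by (intro hyperbolic_derivative_omitted_value[OF hol im1 zi _ w(1)]) auto
      then have "cmod (deriv \<phi> w) * (1 - (cmod w)\<^sup>2) \<le> 2 * sqrt x / (1 + x) * (1 - (cmod (\<phi> w))\<^sup>2)"
        using x0 by (simp add: pos_le_divide_eq add_pos_nonneg)
      ultimately show "cmod (deriv \<phi> w) * (1 - (cmod w)\<^sup>2) \<le> \<kappa> * (1 - (cmod (\<phi> w))\<^sup>2)"
        by (meson less_imp_le mult_right_mono order_trans)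
    qed
    then have b2: "r'\<^sup>2 \<le> 1 - \<eta> * (1 - \<rho>\<^sup>2)" by (simp add: r \<eta>_def)
    \<comment> \<open>The single omitted point \<open>z j\<close>, seen from the origin: there
      \<open>\<phi>\<close> vanishes and the distance \<open>x\<close> is \<rho>.\<close>
    have "r' * (1 + \<rho>) \<le> 2 * sqrt \<rho>"
      using hyperbolic_derivative_omitted_value[OF hol im1 _ omit[OF j(1)], of 0] \<rho>
      by (simp add: j(2) r \<phi>0)
    then have b1: "r' \<le> 2 * sqrt \<rho>"
      using rpos \<rho> by (simp add: algebra_simps) (smt (verit) mult_nonneg_nonneg)
    have "ln r' \<le> ln \<rho> / (32 / \<eta>)"
      by (rule ln_le_of_two_bounds[OF rpos \<rho> \<eta> b1 b2])
    moreover have "ln \<rho> / (32 / \<eta>) < 0"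
      using \<rho> \<eta> by (intro divide_neg_pos) auto
    ultimately show ?thesis by (simp add: \<rho>_def)
  qed
  show ?thesis
    using K1 bound by (intro exI[of _ "32 / \<eta>"] conjI allI impI) blast+
qed

end
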